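(* Let $\theta\in\mathbb H_d(\mathbb R)$ and consider the model $Y_i=\mathrm{tr}(X^i\theta)+\varepsilon_i$, $i=1,\dots,n$, where $\varepsilon_1,\dots,\varepsilon_n$ are i.i.d. $N(0,\sigma^2)$ with $\sigma^2\le v$ for some known constant $v$, independent of the design matrices $X^i$. Assume the entries $X^i_{m,k}$, $1\le m,k\le d$, $1\le i\le n$, are i.i.d. real random variables (across all indices $i,m,k$) with mean zero and unit variance, and that there are fixed constants $\tau_1,\tau_2>0$ such that for every $M\in\mathbb M_d(\mathbb R)$ with $\|M\|_F\le1$ one has $\mathbb E e^{\lambda\,\mathrm{tr}(X^iM)}\le\tau_1e^{\lambda^2\tau_2^2}$ for all $\lambda\in\mathbb R$. Let $\tilde\theta$ be an estimator of $\theta$ computed from an independent initial sample, on which one conditions (so that $\tilde\theta$ is a fixed real $d\times d$ matrix), and let $C_n$ be the confidence set defined in the context, which involves constants $\zeta_1,\zeta_2$. For every $\alpha>0$ one can choose $\zeta_i=\zeta_i(\alpha)=O(\sqrt{1/\alpha})$, $i=1,2$, large enough so that for every $n\in\mathbb N$ (with $n\ge2$, so that $C_n$ is defined) $$\mathbb P_\theta(\theta\in C_n)\ge1-\alpha .$$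
   Context: $\mathbb M_d(\mathbb R)$ is the space of real $d\times d$ matrices, $\mathbb H_d(\mathbb R)$ the set of symmetric ones, $\|\cdot\|_F$ the Frobenius norm, and $\mathbb P_\theta$ the law of $(Y,X)$ given $\theta$ (the second sample of size $n$, conditionally on $\tilde\theta$). Define the $U$-statistic $$\hat R_n=\frac{2}{n(n-1)}\sum_{1\le i<j\le n}\ \sum_{m,k=1}^d\big(Y_iX^i_{m,k}-\tilde\theta_{m,k}\big)\big(Y_jX^j_{m,k}-\tilde\theta_{m,k}\big)$$ and the confidence set $$C_n=\left\{u\in\mathbb H_d(\mathbb R):\ \|u-\tilde\theta\|_F^2\le\hat R_n+z_{\alpha,n}\right\},\qquad z_{\alpha,n}=\frac{C_1\|\theta-\tilde\theta\|_F}{\sqrt n}+\frac{C_2\,d}{n},$$ where $C_1\ge\zeta_1\|\theta\|_F$ and $C_2\ge\zeta_2\|\theta\|_F^2$, with $\zeta_1,\zeta_2$ constants depending on $\alpha$ and on the upper bound $v$ for the noise variance.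
   Formalization: Added: if σ>0 then ‖θ‖_F ≥ r for a fixed r>0, and ζ_1, ζ_2 may depend on r (besides α, v, τ_1, τ_2); at θ=0 with noise the thresholds may vanish and coverage can be 1/2 (d=1, n=2, θ=θ̃=0, X=±1), so the claim fails as stated. *)

theory Defs
  imports
    "HOL-Probability.Probability"
    "HOL-Library.Landau_Symbols"
    "Jordan_Normal_Form.Matrix"
begin

text \<open>
  Real \<open>d \<times> d\<close> matrices are elements of \<open>carrier_mat d d\<close>, so that statements can be
  quantified over \<open>d\<close>. All indices (samples, rows, columns) start at 0.
\<close>

definition mat_trace :: "real mat \<Rightarrow> real" where
  "mat_trace A = (\<Sum>i<dim_row A. A $$ (i, i))"

definition frob_norm :: "real mat \<Rightarrow> real" where
  "frob_norm A = sqrt (\<Sum>m<dim_row A. \<Sum>k<dim_col A. (A $$ (m, k))\<^sup>2)"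

definition sym_mats :: "nat \<Rightarrow> real mat set" where
  "sym_mats d = {A \<in> carrier_mat d d. transpose_mat A = A}"

text \<open>
  A random matrix is represented by its family of entries, a function on index pairs;
  \<open>design_mat d x\<close> is the matrix with entries \<open>x (m, k)\<close>.
\<close>

definition design_mat :: "nat \<Rightarrow> (nat \<times> nat \<Rightarrow> real) \<Rightarrow> real mat" where
  "design_mat d x = Matrix.mat d d x"

definition entries_law :: "nat \<Rightarrow> real measure \<Rightarrow> (nat \<times> nat \<Rightarrow> real) measure" where
  "entries_law d \<mu> = PiM ({..<d} \<times> {..<d}) (\<lambda>_. \<mu>)"

definition standardized :: "real measure \<Rightarrow> bool" where
  "standardized \<mu> \<longleftrightarrow>
     prob_space \<mu> \<and> sets \<mu> = sets borel \<and>
     integrable \<mu> (\<lambda>x. x) \<and> (\<integral>x. x \<partial>\<mu>) = 0 \<and>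
     integrable \<mu> (\<lambda>x. x\<^sup>2) \<and> (\<integral>x. x\<^sup>2 \<partial>\<mu>) = 1"

definition subgaussian_design :: "nat \<Rightarrow> real measure \<Rightarrow> real \<Rightarrow> real \<Rightarrow> bool" where
  "subgaussian_design d \<mu> \<tau>\<^sub>1 \<tau>\<^sub>2 \<longleftrightarrow>
     (\<forall>M \<in> carrier_mat d d. frob_norm M \<le> 1 \<longrightarrow>
        (\<forall>l::real.
           integrable (entries_law d \<mu>) (\<lambda>x. exp (l * mat_trace (design_mat d x * M))) \<and>
           (\<integral>x. exp (l * mat_trace (design_mat d x * M)) \<partial>entries_law d \<mu>)
             \<le> \<tau>\<^sub>1 * exp (l\<^sup>2 * \<tau>\<^sub>2\<^sup>2)))"

text \<open>
  \<open>normal_density 0 0\<close> is not a probability density; the degenerate law \<open>N(0,0)\<close> is the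
  point mass at 0.
\<close>

definition centred_normal :: "real \<Rightarrow> real measure" where
  "centred_normal \<sigma> = (if \<sigma> = 0 then return borel 0 else density lborel (normal_density 0 \<sigma>))"

text \<open>
  The product measures make the matrices \<open>X i\<close>, their entries and the noise variables
  \<open>\<epsilon> i\<close> all mutually independent.
\<close>

definition design_law :: "nat \<Rightarrow> nat \<Rightarrow> real measure \<Rightarrow> (nat \<Rightarrow> nat \<times> nat \<Rightarrow> real) measure" where
  "design_law n d \<mu> = PiM {..<n} (\<lambda>_. entries_law d \<mu>)"

definition noise_law :: "nat \<Rightarrow> real \<Rightarrow> (nat \<Rightarrow> real) measure" where
  "noise_law n \<sigma> = PiM {..<n} (\<lambda>_. centred_normal \<sigma>)"

definition response ::
    "nat \<Rightarrow> nat \<Rightarrow> real mat \<Rightarrow> (nat \<Rightarrow> nat \<times> nat \<Rightarrow> real) \<Rightarrow> (nat \<Rightarrow> real) \<Rightarrow> nat \<Rightarrow> real" where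
  "response n d \<theta> X \<epsilon> = (\<lambda>i\<in>{..<n}. mat_trace (design_mat d (X i) * \<theta>) + \<epsilon> i)"

text \<open>The law of the data \<open>(Y, X)\<close> under the parameter \<open>\<theta>\<close>.\<close>

definition data_law ::
    "nat \<Rightarrow> nat \<Rightarrow> real measure \<Rightarrow> real \<Rightarrow> real mat \<Rightarrow>
     ((nat \<Rightarrow> real) \<times> (nat \<Rightarrow> nat \<times> nat \<Rightarrow> real)) measure" where
  "data_law n d \<mu> \<sigma> \<theta> =
     distr (design_law n d \<mu> \<Otimes>\<^sub>M noise_law n \<sigma>)
       (PiM {..<n} (\<lambda>_. borel) \<Otimes>\<^sub>M PiM {..<n} (\<lambda>_. PiM ({..<d} \<times> {..<d}) (\<lambda>_. borel)))
       (\<lambda>(X, \<epsilon>). (response n d \<theta> X \<epsilon>, X))"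

definition U_stat ::
    "nat \<Rightarrow> nat \<Rightarrow> real mat \<Rightarrow> (nat \<Rightarrow> real) \<Rightarrow> (nat \<Rightarrow> nat \<times> nat \<Rightarrow> real) \<Rightarrow> real" where
  "U_stat n d \<theta>' Y X =
     2 / (real n * (real n - 1)) *
     (\<Sum>j<n. \<Sum>i<j. \<Sum>m<d. \<Sum>k<d.
        (Y i * X i (m, k) - \<theta>' $$ (m, k)) * (Y j * X j (m, k) - \<theta>' $$ (m, k)))"

definition z_term :: "nat \<Rightarrow> nat \<Rightarrow> real \<Rightarrow> real \<Rightarrow> real mat \<Rightarrow> real mat \<Rightarrow> real" where
  "z_term n d C\<^sub>1 C\<^sub>2 \<theta> \<theta>' = C\<^sub>1 * frob_norm (\<theta> - \<theta>') / sqrt (real n) + C\<^sub>2 * real d / real n"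

definition conf_set ::
    "nat \<Rightarrow> nat \<Rightarrow> real mat \<Rightarrow> real \<Rightarrow> (nat \<Rightarrow> real) \<Rightarrow> (nat \<Rightarrow> nat \<times> nat \<Rightarrow> real) \<Rightarrow> real mat set" where
  "conf_set n d \<theta>' z Y X =
     {u \<in> sym_mats d. (frob_norm (u - \<theta>'))\<^sup>2 \<le> U_stat n d \<theta>' Y X + z}"

end

theory Submission
  imports Defs
begin

text \<open>
  Write \<open>\<delta> = \<theta> - \<theta>'\<close> and let \<open>Z\<^sub>i = Y\<^sub>i X\<^sup>i - \<theta>\<close> be the score of observation \<open>i\<close>. Since the entries of
  \<open>X\<^sup>i\<close> are uncorrelated with unit variance and \<open>\<theta>\<close> is symmetric, the scores are centred, and they are
  independent. Expanding the products in the U-statistic around \<open>\<delta>\<close> gives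
  (\<open>U_stat_decomposition\<close>)

    \<open>R\<^sub>n - \<parallel>\<delta>\<parallel>\<^sup>2 = 2 / (n (n - 1)) \<Sum>\<^bsub>i<j\<^esub> \<langle>Z\<^sub>i, Z\<^sub>j\<rangle> + 2 / n \<Sum>\<^sub>i \<langle>Z\<^sub>i, \<delta>\<rangle>\<close>,

  so \<open>\<theta>\<close> can only leave the confidence set if one of the two centred sums is below minus its
  share of the threshold. Both events are controlled by Chebyshev's inequality, which is what makes
  the constants grow like \<open>sqrt (1 / \<alpha>)\<close>.

  The one probabilistic input is a variance bound that is uniform over directions:
  \<open>E \<langle>Z\<^sub>i, s\<rangle>\<^sup>2 \<le> \<beta> \<parallel>s\<parallel>\<^sup>2\<close> with \<open>\<beta> = K \<parallel>\<theta>\<parallel>\<^sup>2\<close> (\<open>centred_scores_regression\<close>). The sub-Gaussian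
  hypothesis enters only there: it bounds \<open>E \<langle>X, s\<rangle>\<^sup>2 \<langle>X, \<theta>\<rangle>\<^sup>2\<close> by a constant times
  \<open>\<parallel>s\<parallel>\<^sup>2 \<parallel>\<theta>\<parallel>\<^sup>2\<close>, and the noise contributes \<open>\<sigma>\<^sup>2 \<parallel>s\<parallel>\<^sup>2\<close>, where \<open>\<sigma>\<^sup>2 \<le> v \<le> (v / r\<^sup>2) \<parallel>\<theta>\<parallel>\<^sup>2\<close> unless
  \<open>\<sigma> = 0\<close>.

  From this bound the linear sum has second moment at most \<open>n \<beta> \<parallel>\<delta>\<parallel>\<^sup>2\<close>. For the pair sum, one adds
  observations one at a time: given the past, the new term is \<open>\<langle>S, Z\<^sub>j\<rangle>\<close> with \<open>S\<close> the sum of the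
  earlier scores, so it is orthogonal to the past and has conditional second moment at most
  \<open>\<beta> \<parallel>S\<parallel>\<^sup>2\<close>. As \<open>S\<close> has \<open>d\<^sup>2\<close> coordinates, each with second moment at most \<open>j \<beta>\<close>, the pair sum
  has second moment at most \<open>\<beta>\<^sup>2 d\<^sup>2 n (n - 1) / 2\<close> (\<open>nn_integral_pair_square_le\<close>). After normalisation
  this is of order \<open>(\<beta> d / n)\<^sup>2\<close>, which produces the term \<open>C\<^sub>2 d / n\<close> of the threshold.
\<close>

section \<open>Fubini for one more observation\<close>

text \<open>
  Integrating out one coordinate of both product measures at once. This turns every second moment
  of a sample of \<open>n + 1\<close> pairs into a conditional second moment given the first \<open>n\<close> pairs. The
  design and the noise are kept as two separate product measures.
\<close>

lemma nn_integral_pair_PiM_insert: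
  fixes A :: "'a measure" and B :: "'b measure"
  assumes A: "prob_space A" and B: "prob_space B" and I: "finite I" "i \<notin> I"
    and f[measurable]: "f \<in> borel_measurable (PiM (insert i I) (\<lambda>_. A) \<Otimes>\<^sub>M PiM (insert i I) (\<lambda>_. B))"
  shows "(\<integral>\<^sup>+p. f p \<partial>(PiM (insert i I) (\<lambda>_. A) \<Otimes>\<^sub>M PiM (insert i I) (\<lambda>_. B))) =
    (\<integral>\<^sup>+p. \<integral>\<^sup>+q. f ((fst p)(i := fst q), (snd p)(i := snd q)) \<partial>(A \<Otimes>\<^sub>M B)
       \<partial>(PiM I (\<lambda>_. A) \<Otimes>\<^sub>M PiM I (\<lambda>_. B)))"
    (is "?lhs = ?rhs")
proof -
  interpret A: prob_space A by (rule A)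
  interpret B: prob_space B by (rule B)
  interpret PA: product_prob_space "\<lambda>_. A" I ..
  interpret PB: product_prob_space "\<lambda>_. B" I ..
  have IB: "sigma_finite_measure (PiM I (\<lambda>_. B))"
    by (rule prob_space_imp_sigma_finite, rule prob_space_PiM, rule B)
  have AB: "sigma_finite_measure (A \<Otimes>\<^sub>M B)"
    by (rule prob_space_imp_sigma_finite, rule prob_space_pair, rule A, rule B)
  interpret JB: prob_space "PiM (insert i I) (\<lambda>_. B)" by (rule prob_space_PiM) (rule B)
  interpret swap: pair_sigma_finite A "PiM I (\<lambda>_. B)" ..
  have m2: "(\<lambda>e. f (x, e)) \<in> borel_measurable (PiM (insert i I) (\<lambda>_. B))"
    if "x \<in> space (PiM (insert i I) (\<lambda>_. A))" for x
    using that by measurable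
  have g4: "(\<lambda>z. f ((a z)(i := b z), (c z)(i := d z))) \<in> borel_measurable N"
    if "a \<in> N \<rightarrow>\<^sub>M PiM I (\<lambda>_. A)" "b \<in> N \<rightarrow>\<^sub>M A" "c \<in> N \<rightarrow>\<^sub>M PiM I (\<lambda>_. B)" "d \<in> N \<rightarrow>\<^sub>M B"
    for a b c d and N :: "'z measure"
    by (rule measurable_compose[OF _ f], intro measurable_Pair measurable_fun_upd[where J = I] that) auto
  have g3: "(\<lambda>z. \<integral>\<^sup>+w. f ((a z)(i := b z), (c z)(i := w)) \<partial>B) \<in> borel_measurable N"
    if [measurable]: "a \<in> N \<rightarrow>\<^sub>M PiM I (\<lambda>_. A)" "b \<in> N \<rightarrow>\<^sub>M A" "c \<in> N \<rightarrow>\<^sub>M PiM I (\<lambda>_. B)"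
    for a b c and N :: "'z measure"
    by (rule B.borel_measurable_nn_integral, unfold split_beta', rule g4) measurable
  \<comment> \<open>Split off the coordinate \<open>i\<close> in each factor; the two middle integrals are then in the
    wrong order and have to be exchanged.\<close>
  have "?lhs = (\<integral>\<^sup>+x. \<integral>\<^sup>+e. f (x, e) \<partial>PiM (insert i I) (\<lambda>_. B) \<partial>PiM (insert i I) (\<lambda>_. A))"
    by (rule JB.nn_integral_fst[symmetric]) measurable
  also have "\<dots> = (\<integral>\<^sup>+x. \<integral>\<^sup>+y. \<integral>\<^sup>+e. f (x(i := y), e) \<partial>PiM (insert i I) (\<lambda>_. B) \<partial>A \<partial>PiM I (\<lambda>_. A))"
    by (rule PA.product_nn_integral_insert[OF I]) measurable
  also have "\<dots> = (\<integral>\<^sup>+x. \<integral>\<^sup>+y. \<integral>\<^sup>+e. \<integral>\<^sup>+w. f (x(i := y), e(i := w)) \<partial>B \<partial>PiM I (\<lambda>_. B) \<partial>A \<partial>PiM I (\<lambda>_. A))"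
    by (intro nn_integral_cong PB.product_nn_integral_insert[OF I] m2)
       (auto simp: space_PiM PiE_def extensional_def)
  also have "\<dots> = (\<integral>\<^sup>+x. \<integral>\<^sup>+e. \<integral>\<^sup>+y. \<integral>\<^sup>+w. f (x(i := y), e(i := w)) \<partial>B \<partial>A \<partial>PiM I (\<lambda>_. B) \<partial>PiM I (\<lambda>_. A))"
    by (intro nn_integral_cong swap.Fubini'[symmetric])
       (unfold split_beta', rule g3, auto)
  also have "\<dots> = (\<integral>\<^sup>+x. \<integral>\<^sup>+e. \<integral>\<^sup>+q. f (x(i := fst q), e(i := snd q)) \<partial>(A \<Otimes>\<^sub>M B) \<partial>PiM I (\<lambda>_. B) \<partial>PiM I (\<lambda>_. A))"
    by (intro nn_integral_cong, subst B.nn_integral_fst[symmetric], rule g4, auto)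
  also have "\<dots> = ?rhs"
    by (subst sigma_finite_measure.nn_integral_fst[OF IB, symmetric],
        rule sigma_finite_measure.borel_measurable_nn_integral[OF AB], unfold split_beta', rule g4, auto)
  finally show ?thesis .
qed

section \<open>Second moments of sums of centred scores\<close>

text \<open>
  Chebyshev's inequality, arranged to survive \<open>c = 0\<close>: then the second moment vanishes, so \<open>f\<close> is
  almost surely zero and the strict inequality has probability zero. This case occurs when the
  estimator is exact or when \<open>\<theta> = 0\<close>.
\<close>

lemma (in prob_space) prob_less_neg_le_second_moment:
  fixes f :: "'a \<Rightarrow> real"
  assumes f[measurable]: "f \<in> borel_measurable M"
    and moment: "(\<integral>\<^sup>+x. ennreal ((f x)\<^sup>2) \<partial>M) \<le> ennreal (\<gamma> * c\<^sup>2)"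
    and c: "0 \<le> c" and \<gamma>: "0 \<le> \<gamma>"
  shows "prob {x \<in> space M. f x < - c} \<le> \<gamma>"
proof (cases "c = 0")
  case True
  then have "(\<integral>\<^sup>+x. ennreal ((f x)\<^sup>2) \<partial>M) = 0"
    using moment by simp
  then have "AE x in M. ennreal ((f x)\<^sup>2) = 0"
    by (subst (asm) nn_integral_0_iff_AE) auto
  then have "AE x in M. \<not> f x < - c"
    by eventually_elim (simp add: True)
  then have "prob {x \<in> space M. f x < - c} = 0"
    by (subst (asm) AE_iff_measurable[OF _ refl]) (auto simp: measure_def)
  then show ?thesis using \<gamma> by simp
next
  case False
  let ?S = "{x \<in> space M. f x < - c}"
  have S: "?S \<in> sets M" by measurable
  have "ennreal (c\<^sup>2 * prob ?S) = (\<integral>\<^sup>+x. ennreal (c\<^sup>2) * indicator ?S x \<partial>M)"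
    using S by (simp add: nn_integral_cmult_indicator emeasure_eq_measure ennreal_mult)
  also have "\<dots> \<le> (\<integral>\<^sup>+x. ennreal ((f x)\<^sup>2) \<partial>M)"
  proof (intro nn_integral_mono)
    fix x
    have "c\<^sup>2 \<le> (f x)\<^sup>2" if "f x < - c"
      using that c power_mono[of c "- f x" 2] by simp
    then show "ennreal (c\<^sup>2) * indicator ?S x \<le> ennreal ((f x)\<^sup>2)"
      by (auto simp: indicator_def intro: ennreal_leI)
  qed
  also have "\<dots> \<le> ennreal (\<gamma> * c\<^sup>2)" by (rule moment)
  finally have "c\<^sup>2 * prob ?S \<le> \<gamma> * c\<^sup>2"
    using \<gamma> by (subst (asm) ennreal_le_iff) auto
  then show ?thesis using False c by (simp add: mult.commute[of \<gamma>])
qed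

text \<open>
  The assumption \<open>score_bound\<close> packs two facts into one inequality: it holds for all offsets \<open>u\<close>
  exactly when the linear forms in the scores are centred and have variance at most
  \<open>\<beta> \<parallel>s\<parallel>\<^sup>2\<close>. Stated for the Lebesgue integral of nonnegative functions, it lets moments of sums be
  bounded by induction without any separate integrability proof.
\<close>

locale centred_scores =
  A: prob_space A + B: prob_space B for A :: "'a measure" and B :: "'b measure" +
  fixes D :: "'c set" and Z :: "'c \<Rightarrow> 'a \<Rightarrow> 'b \<Rightarrow> real" and \<beta> :: real
  assumes finite_D: "finite D" and \<beta>_nonneg: "0 \<le> \<beta>"
    and measurable_Z: "c \<in> D \<Longrightarrow> (\<lambda>q. Z c (fst q) (snd q)) \<in> borel_measurable (A \<Otimes>\<^sub>M B)"
    and score_bound: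
      "(\<integral>\<^sup>+q. ennreal ((u + (\<Sum>c\<in>D. s c * Z c (fst q) (snd q)))\<^sup>2) \<partial>(A \<Otimes>\<^sub>M B))
         \<le> ennreal (u\<^sup>2 + \<beta> * (\<Sum>c\<in>D. (s c)\<^sup>2))"
begin

abbreviation sample :: "nat \<Rightarrow> ((nat \<Rightarrow> 'a) \<times> (nat \<Rightarrow> 'b)) measure" where
  "sample n \<equiv> PiM {..<n} (\<lambda>_. A) \<Otimes>\<^sub>M PiM {..<n} (\<lambda>_. B)"

abbreviation score :: "(nat \<Rightarrow> 'a) \<times> (nat \<Rightarrow> 'b) \<Rightarrow> nat \<Rightarrow> 'c \<Rightarrow> real" where
  "score p i c \<equiv> Z c (fst p i) (snd p i)"

lemma measurable_score [measurable]:
  assumes "c \<in> D" "i < n"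
  shows "(\<lambda>p. score p i c) \<in> borel_measurable (sample n)"
proof -
  have "(\<lambda>p. (fst p i, snd p i)) \<in> sample n \<rightarrow>\<^sub>M A \<Otimes>\<^sub>M B"
    using assms by (intro measurable_Pair) (auto intro!: measurable_compose[OF measurable_fst]
      measurable_compose[OF measurable_snd] measurable_component_singleton)
  from measurable_compose[OF this measurable_Z[OF assms(1)]] show ?thesis by simp
qed

text \<open>
  Here \<open>u\<close> and \<open>s\<close> depend on the past only, so the bound on a single score applies for each fixed
  past.
\<close>

lemma nn_integral_square_step:
  assumes F: "F \<in> borel_measurable (sample (Suc n))"
    and split: "\<And>x e y w. F (x(n := y), e(n := w)) = u (x, e) + (\<Sum>c\<in>D. s c (x, e) * Z c y w)"
  shows "(\<integral>\<^sup>+p. ennreal ((F p)\<^sup>2) \<partial>sample (Suc n))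
    \<le> (\<integral>\<^sup>+p. ennreal ((u p)\<^sup>2 + \<beta> * (\<Sum>c\<in>D. (s c p)\<^sup>2)) \<partial>sample n)"
proof -
  have F2: "(\<lambda>p. ennreal ((F p)\<^sup>2)) \<in> borel_measurable (sample (Suc n))"
    using F by measurable
  have "(\<integral>\<^sup>+p. ennreal ((F p)\<^sup>2) \<partial>sample (Suc n)) =
    (\<integral>\<^sup>+p. \<integral>\<^sup>+q. ennreal ((u p + (\<Sum>c\<in>D. s c p * Z c (fst q) (snd q)))\<^sup>2) \<partial>(A \<Otimes>\<^sub>M B) \<partial>sample n)"
    using nn_integral_pair_PiM_insert[OF A.prob_space_axioms B.prob_space_axioms,
        of "{..<n}" n "\<lambda>p. ennreal ((F p)\<^sup>2)"] F2
    by (simp add: lessThan_Suc split)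
  also have "\<dots> \<le> (\<integral>\<^sup>+p. ennreal ((u p)\<^sup>2 + \<beta> * (\<Sum>c\<in>D. (s c p)\<^sup>2)) \<partial>sample n)"
    by (intro nn_integral_mono score_bound)
  finally show ?thesis .
qed

lemma prob_space_sample: "prob_space (sample n)"
  by (intro prob_space_pair prob_space_PiM A.prob_space_axioms B.prob_space_axioms)

lemma nn_integral_linear_square_le:
  "(\<integral>\<^sup>+p. ennreal ((\<Sum>i<n. \<Sum>c\<in>D. t c * score p i c)\<^sup>2) \<partial>sample n)
     \<le> ennreal (real n * (\<beta> * (\<Sum>c\<in>D. (t c)\<^sup>2)))"
proof (induction n)
  case 0
  show ?case by simp
next
  case (Suc n)
  interpret S: prob_space "sample n" by (rule prob_space_sample)
  let ?L = "\<lambda>p. \<Sum>i<n. \<Sum>c\<in>D. t c * score p i c"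
  let ?b = "\<beta> * (\<Sum>c\<in>D. (t c)\<^sup>2)"
  have b: "0 \<le> ?b" by (simp add: \<beta>_nonneg sum_nonneg)
  have "(\<integral>\<^sup>+p. ennreal ((\<Sum>i<Suc n. \<Sum>c\<in>D. t c * score p i c)\<^sup>2) \<partial>sample (Suc n))
      \<le> (\<integral>\<^sup>+p. ennreal ((?L p)\<^sup>2 + ?b) \<partial>sample n)"
    by (rule nn_integral_square_step[where s = "\<lambda>c _. t c"])
       (auto intro!: borel_measurable_sum borel_measurable_times measurable_score)
  also have "\<dots> = (\<integral>\<^sup>+p. ennreal ((?L p)\<^sup>2) \<partial>sample n) + ennreal ?b"
    using b by (simp add: ennreal_plus nn_integral_add S.emeasure_space_1)
  also have "\<dots> \<le> ennreal (real n * ?b) + ennreal ?b"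
    by (intro add_mono Suc.IH order_refl)
  also have "\<dots> = ennreal (real (Suc n) * ?b)"
    using b by (subst ennreal_plus[symmetric]) (auto simp: algebra_simps intro!: mult_nonneg_nonneg sum_nonneg \<beta>_nonneg)
  finally show ?case .
qed

text \<open>
  This is where the dimension enters: each of the \<open>card D\<close> coordinates of the sum of the scores is
  a linear form in a unit direction.
\<close>

lemma nn_integral_coordinate_sums_le:
  "(\<integral>\<^sup>+p. ennreal (\<Sum>c\<in>D. (\<Sum>i<n. score p i c)\<^sup>2) \<partial>sample n)
     \<le> ennreal (real n * real (card D) * \<beta>)"
proof -
  have one: "(\<integral>\<^sup>+p. ennreal ((\<Sum>i<n. score p i c)\<^sup>2) \<partial>sample n) \<le> ennreal (real n * \<beta>)"
    if "c \<in> D" for c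
    using nn_integral_linear_square_le[where n = n and t = "\<lambda>c'. if c' = c then 1 else 0"] that finite_D
    by (simp add: if_distrib[of "\<lambda>x. x * _"] if_distrib[of "\<lambda>x. x ^ _"] sum.delta cong: if_cong)
  have "(\<integral>\<^sup>+p. ennreal (\<Sum>c\<in>D. (\<Sum>i<n. score p i c)\<^sup>2) \<partial>sample n)
    = (\<Sum>c\<in>D. \<integral>\<^sup>+p. ennreal ((\<Sum>i<n. score p i c)\<^sup>2) \<partial>sample n)"
    by (subst nn_integral_sum[symmetric]) (auto simp: sum_ennreal)
  also have "\<dots> \<le> (\<Sum>c\<in>D. ennreal (real n * \<beta>))"
    by (intro sum_mono one)
  also have "\<dots> = ennreal (real n * real (card D) * \<beta>)"
    using \<beta>_nonneg by (simp add: ennreal_of_nat_eq_real_of_nat ennreal_mult[symmetric] mult_ac)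
  finally show ?thesis .
qed

text \<open>
  The pairs are summed by their later index. The new observation \<open>n\<close> contributes the linear form
  in its score whose coefficients are the coordinates of the sum of the earlier scores, so the second
  moment grows by at most \<open>\<beta>\<close> times the second moment of that sum.
\<close>

lemma nn_integral_pair_square_le:
  "(\<integral>\<^sup>+p. ennreal ((\<Sum>j<n. \<Sum>i<j. \<Sum>c\<in>D. score p i c * score p j c)\<^sup>2) \<partial>sample n)
     \<le> ennreal (\<beta>\<^sup>2 * real (card D) * (real n * (real n - 1) / 2))"
proof (induction n)
  case 0
  show ?case by simp
next
  case (Suc n)
  let ?V = "\<lambda>n p. \<Sum>j<n. \<Sum>i<j. \<Sum>c\<in>D. score p i c * score p j c"
  let ?S = "\<lambda>p. \<Sum>c\<in>D. (\<Sum>i<n. score p i c)\<^sup>2"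
  let ?k = "real (card D)"
  have split: "?V (Suc n) (x(n := y), e(n := w))
      = ?V n (x, e) + (\<Sum>c\<in>D. (\<Sum>i<n. score (x, e) i c) * Z c y w)" for x e y w
    by (simp add: sum_distrib_right sum.swap[of _ _ D])
  have meas: "?V (Suc n) \<in> borel_measurable (sample (Suc n))"
    by (intro borel_measurable_sum borel_measurable_times measurable_score) auto
  have [measurable]: "?V n \<in> borel_measurable (sample n)" "?S \<in> borel_measurable (sample n)"
    by (intro borel_measurable_sum borel_measurable_times borel_measurable_power measurable_score; auto)+
  have "(\<integral>\<^sup>+p. ennreal ((?V (Suc n) p)\<^sup>2) \<partial>sample (Suc n))
      \<le> (\<integral>\<^sup>+p. ennreal ((?V n p)\<^sup>2 + \<beta> * ?S p) \<partial>sample n)"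
    using meas split by (rule nn_integral_square_step)
  also have "\<dots> = (\<integral>\<^sup>+p. ennreal ((?V n p)\<^sup>2) \<partial>sample n) + ennreal \<beta> * (\<integral>\<^sup>+p. ennreal (?S p) \<partial>sample n)"
    using \<beta>_nonneg
    by (simp add: ennreal_plus ennreal_mult' nn_integral_add nn_integral_cmult sum_nonneg)
  also have "\<dots> \<le> ennreal (\<beta>\<^sup>2 * ?k * (real n * (real n - 1) / 2)) + ennreal \<beta> * ennreal (real n * ?k * \<beta>)"
    by (intro add_mono mult_left_mono Suc.IH nn_integral_coordinate_sums_le) auto
  also have "\<dots> = ennreal (\<beta>\<^sup>2 * ?k * (real (Suc n) * (real (Suc n) - 1) / 2))"
  proof -
    have "0 \<le> \<beta>\<^sup>2 * ?k * (real n * (real n - 1) / 2)"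
      by (cases n) auto
    then show ?thesis
      using \<beta>_nonneg by (simp add: ennreal_mult[symmetric] ennreal_plus[symmetric] power2_eq_square
          field_simps del: ennreal_plus)
  qed
  finally show ?case .
qed

text \<open>
  Chebyshev's inequality at level \<open>\<alpha> / 2\<close> for each of the two sums; the hypotheses on \<open>z\<^sub>1\<close> and
  \<open>z\<^sub>2\<close> compare them with the standard deviations after normalisation.
\<close>

lemma prob_pair_plus_linear_le:
  assumes n: "2 \<le> n" and z: "0 \<le> z\<^sub>1" "0 \<le> z\<^sub>2" and \<alpha>: "0 \<le> \<alpha>"
    and z1: "4 * (\<beta> * (\<Sum>c\<in>D. (\<delta> c)\<^sup>2)) / n \<le> \<alpha> / 2 * z\<^sub>1\<^sup>2"
    and z2: "2 * (\<beta>\<^sup>2 * card D) / (n * (real n - 1)) \<le> \<alpha> / 2 * z\<^sub>2\<^sup>2"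
  shows "measure (sample n) {p \<in> space (sample n).
      2 / (n * (real n - 1)) * (\<Sum>j<n. \<Sum>i<j. \<Sum>c\<in>D. score p i c * score p j c)
      + 2 / n * (\<Sum>i<n. \<Sum>c\<in>D. \<delta> c * score p i c) < - (z\<^sub>1 + z\<^sub>2)} \<le> \<alpha>"
    (is "measure _ {p \<in> _. ?a * ?V p + ?b * ?L p < _} \<le> _")
proof -
  interpret S: prob_space "sample n" by (rule prob_space_sample)
  have meas [measurable]: "?V \<in> borel_measurable (sample n)" "?L \<in> borel_measurable (sample n)"
    by (intro borel_measurable_sum borel_measurable_times measurable_score; auto)+
  have pos: "0 < real n" "0 < real n - 1" using n by auto
  have V: "S.prob {p \<in> space (sample n). ?V p < - (n * (real n - 1) / 2 * z\<^sub>2)} \<le> \<alpha> / 2"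
  proof (rule S.prob_less_neg_le_second_moment)
    have "\<beta>\<^sup>2 * real (card D) * (real n * (real n - 1) / 2)
        = (2 * (\<beta>\<^sup>2 * card D) / (n * (real n - 1))) * (n * (real n - 1) / 2)\<^sup>2"
      using pos by (simp add: power2_eq_square)
    also have "\<dots> \<le> (\<alpha> / 2 * z\<^sub>2\<^sup>2) * (n * (real n - 1) / 2)\<^sup>2"
      by (intro mult_right_mono z2) auto
    also have "\<dots> = \<alpha> / 2 * (n * (real n - 1) / 2 * z\<^sub>2)\<^sup>2"
      by (simp only: power_mult_distrib mult_ac)
    finally show "(\<integral>\<^sup>+p. ennreal ((?V p)\<^sup>2) \<partial>sample n) \<le> ennreal (\<alpha> / 2 * (n * (real n - 1) / 2 * z\<^sub>2)\<^sup>2)"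
      by (intro order_trans[OF nn_integral_pair_square_le] ennreal_leI)
  qed (use pos z \<alpha> in auto)
  have L: "S.prob {p \<in> space (sample n). ?L p < - (n / 2 * z\<^sub>1)} \<le> \<alpha> / 2"
  proof (rule S.prob_less_neg_le_second_moment)
    have "real n * (\<beta> * (\<Sum>c\<in>D. (\<delta> c)\<^sup>2)) = (4 * (\<beta> * (\<Sum>c\<in>D. (\<delta> c)\<^sup>2)) / n) * (n / 2)\<^sup>2"
      using pos by (simp add: power2_eq_square)
    also have "\<dots> \<le> (\<alpha> / 2 * z\<^sub>1\<^sup>2) * (n / 2)\<^sup>2"
      by (intro mult_right_mono z1) auto
    also have "\<dots> = \<alpha> / 2 * (n / 2 * z\<^sub>1)\<^sup>2"
      by (simp only: power_mult_distrib mult_ac)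
    finally show "(\<integral>\<^sup>+p. ennreal ((?L p)\<^sup>2) \<partial>sample n) \<le> ennreal (\<alpha> / 2 * (n / 2 * z\<^sub>1)\<^sup>2)"
      by (intro order_trans[OF nn_integral_linear_square_le] ennreal_leI)
  qed (use pos z \<alpha> in auto)
  have "S.prob {p \<in> space (sample n). ?a * ?V p + ?b * ?L p < - (z\<^sub>1 + z\<^sub>2)}
    \<le> S.prob ({p \<in> space (sample n). ?V p < - (n * (real n - 1) / 2 * z\<^sub>2)}
            \<union> {p \<in> space (sample n). ?L p < - (n / 2 * z\<^sub>1)})"
  proof (rule S.finite_measure_mono, rule subsetI)
    fix p assume p: "p \<in> {p \<in> space (sample n). ?a * ?V p + ?b * ?L p < - (z\<^sub>1 + z\<^sub>2)}"
    show "p \<in> {p \<in> space (sample n). ?V p < - (n * (real n - 1) / 2 * z\<^sub>2)}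
            \<union> {p \<in> space (sample n). ?L p < - (n / 2 * z\<^sub>1)}"
    proof (rule ccontr)
      assume "\<not> ?thesis"
      with p have vl: "- (n * (real n - 1) / 2 * z\<^sub>2) \<le> ?V p" "- (n / 2 * z\<^sub>1) \<le> ?L p"
        by auto
      have "?a * - (n * (real n - 1) / 2 * z\<^sub>2) \<le> ?a * ?V p"
        by (rule mult_left_mono[OF vl(1)]) (use pos in simp)
      moreover have "?b * - (n / 2 * z\<^sub>1) \<le> ?b * ?L p"
        by (rule mult_left_mono[OF vl(2)]) (use pos in simp)
      moreover have "?a * - (n * (real n - 1) / 2 * z\<^sub>2) = - z\<^sub>2" "?b * - (n / 2 * z\<^sub>1) = - z\<^sub>1"
        using pos by auto
      ultimately have "- (z\<^sub>1 + z\<^sub>2) \<le> ?a * ?V p + ?b * ?L p"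
        by linarith
      with p show False unfolding mem_Collect_eq by linarith
    qed
  qed measurable
  also have "\<dots> \<le> S.prob {p \<in> space (sample n). ?V p < - (n * (real n - 1) / 2 * z\<^sub>2)}
            + S.prob {p \<in> space (sample n). ?L p < - (n / 2 * z\<^sub>1)}"
    by (rule measure_Un_le) measurable
  also have "\<dots> \<le> \<alpha>" using V L by simp
  finally show ?thesis .
qed

end

section \<open>Moments of linear forms in the design\<close>

definition dot :: "'c set \<Rightarrow> ('c \<Rightarrow> real) \<Rightarrow> ('c \<Rightarrow> real) \<Rightarrow> real" where
  "dot D s x = (\<Sum>c\<in>D. s c * x c)"

definition sq_norm :: "'c set \<Rightarrow> ('c \<Rightarrow> real) \<Rightarrow> real" where
  "sq_norm D s = (\<Sum>c\<in>D. (s c)\<^sup>2)"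

lemma sq_norm_nonneg [simp]: "0 \<le> sq_norm D s"
  by (simp add: sq_norm_def sum_nonneg)

text \<open>
  The sub-Gaussian condition with linear forms in place of traces, over an arbitrary index set.
\<close>

definition subgaussian_family ::
    "'c set \<Rightarrow> ('c \<Rightarrow> real) measure \<Rightarrow> real \<Rightarrow> real \<Rightarrow> bool" where
  "subgaussian_family D A \<tau>\<^sub>1 \<tau>\<^sub>2 \<longleftrightarrow>
     (\<forall>s. sq_norm D s \<le> 1 \<longrightarrow>
        (\<forall>l. integrable A (\<lambda>x. exp (l * dot D s x)) \<and>
             (\<integral>x. exp (l * dot D s x) \<partial>A) \<le> \<tau>\<^sub>1 * exp (l\<^sup>2 * \<tau>\<^sub>2\<^sup>2)))"

text \<open>
  From \<open>(1 + t / 4)\<^sup>4 \<le> exp t\<close> for \<open>t \<ge> 0\<close>, whence \<open>256 = 4\<^sup>4\<close>.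
\<close>

lemma power4_le_exp: "t ^ 4 \<le> 256 * (exp t + exp (- t))" for t :: real
proof -
  have "(\<bar>t\<bar> / 4) ^ 4 \<le> (1 + \<bar>t\<bar> / 4) ^ 4"
    by (rule power_mono) auto
  also have "\<dots> \<le> exp \<bar>t\<bar>"
    using exp_ge_one_plus_x_over_n_power_n[of 4 "\<bar>t\<bar>"] by simp
  also have "\<dots> \<le> exp t + exp (- t)"
    by (cases "0 \<le> t") auto
  finally show ?thesis
    by (simp add: power_divide)
qed

lemma borel_measurable_dot:
  assumes "sets \<mu> = sets borel"
  shows "dot D s \<in> borel_measurable (PiM D (\<lambda>_. \<mu>))"
proof -
  have "(\<lambda>x. x c) \<in> borel_measurable (PiM D (\<lambda>_. \<mu>))" if "c \<in> D" for c
    using measurable_component_singleton[OF that, of "\<lambda>_. \<mu>"] assms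
    by (simp cong: measurable_cong_sets)
  then show ?thesis
    unfolding dot_def by (intro borel_measurable_sum borel_measurable_times) auto
qed

text \<open>
  The product of two coordinates is written as a product over all coordinates, most of whose
  factors are 1, so that the product formula for integrals applies.
\<close>

lemma standardized_coordinate_moments:
  assumes \<mu>: "standardized \<mu>" and D: "finite D" and ab: "a \<in> D" "b \<in> D"
  shows "integrable (PiM D (\<lambda>_. \<mu>)) (\<lambda>x. x a * x b)"
    and "(\<integral>x. x a * x b \<partial>PiM D (\<lambda>_. \<mu>)) = (if a = b then 1 else 0)"
proof -
  interpret prob_space \<mu> using \<mu> by (simp add: standardized_def)
  interpret P: product_prob_space "\<lambda>_. \<mu>" D ..
  define f :: "_ \<Rightarrow> real \<Rightarrow> real"
    where "f = (\<lambda>c t. (if c = a then t else 1) * (if c = b then t else 1))"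
  have prod: "(\<Prod>c\<in>D. f c (x c)) = x a * x b" for x
    using D ab by (simp add: f_def prod.distrib prod.delta)
  have f_int: "integrable \<mu> (f c)" for c
    using \<mu> by (cases "c = a"; cases "c = b") (auto simp: f_def standardized_def power2_eq_square)
  have val: "(\<Prod>c\<in>D. integral\<^sup>L \<mu> (f c)) = (if a = b then 1 else 0)"
  proof (cases "a = b")
    case True
    have "integral\<^sup>L \<mu> (f c) = 1" for c
      using \<mu> True by (cases "c = a") (auto simp: f_def standardized_def power2_eq_square prob_space)
    then show ?thesis using True by simp
  next
    case False
    have "integral\<^sup>L \<mu> (f a) = 0"
      using \<mu> False by (auto simp: f_def standardized_def)
    then show ?thesis using False D ab by (auto intro: prod_zero)
  qed
  show "integrable (PiM D (\<lambda>_. \<mu>)) (\<lambda>x. x a * x b)"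
    unfolding prod[symmetric] by (intro P.product_integrable_prod D f_int)
  show "(\<integral>x. x a * x b \<partial>PiM D (\<lambda>_. \<mu>)) = (if a = b then 1 else 0)"
    unfolding prod[symmetric] val[symmetric] by (intro P.product_integral_prod D f_int)
qed

lemma dot_product_moments:
  assumes \<mu>: "standardized \<mu>" and D: "finite D"
  shows "integrable (PiM D (\<lambda>_. \<mu>)) (\<lambda>x. dot D s x * dot D t x)"
    and "(\<integral>x. dot D s x * dot D t x \<partial>PiM D (\<lambda>_. \<mu>)) = dot D s t"
proof -
  have expand: "dot D s x * dot D t x = (\<Sum>a\<in>D. \<Sum>b\<in>D. (s a * t b) * (x a * x b))" for x
    by (simp add: dot_def sum_product mult_ac)
  have "has_bochner_integral (PiM D (\<lambda>_. \<mu>)) (\<lambda>x. dot D s x * dot D t x)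
      (\<Sum>a\<in>D. \<Sum>b\<in>D. (s a * t b) * (if a = b then 1 else 0))"
    unfolding expand
    by (intro has_bochner_integral_sum has_bochner_integral_mult_right)
       (simp add: has_bochner_integral_iff standardized_coordinate_moments[OF \<mu> D])
  moreover have "(\<Sum>a\<in>D. \<Sum>b\<in>D. (s a * t b) * (if a = b then 1 else 0)) = dot D s t"
    using D by (simp add: dot_def if_distrib[of "\<lambda>x. _ * x"] sum.delta cong: if_cong)
  ultimately show "integrable (PiM D (\<lambda>_. \<mu>)) (\<lambda>x. dot D s x * dot D t x)"
    "(\<integral>x. dot D s x * dot D t x \<partial>PiM D (\<lambda>_. \<mu>)) = dot D s t"
    by (simp_all add: has_bochner_integral_iff)
qed

text \<open>
  For coefficient vectors in the unit ball, a square of a product is at most half the sum of the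
  fourth powers, and these are dominated by the exponential moments at \<open>l = 1\<close> and \<open>l = -1\<close>: four
  terms with factor 128 give the constant 512. The general case follows by homogeneity.
\<close>

lemma subgaussian_fourth_moment:
  assumes sg: "subgaussian_family D A \<tau>\<^sub>1 \<tau>\<^sub>2" and D: "finite D"
    and meas: "\<And>s. dot D s \<in> borel_measurable A"
  shows "integrable A (\<lambda>x. (dot D s x * dot D t x)\<^sup>2)"
    and "(\<integral>x. (dot D s x * dot D t x)\<^sup>2 \<partial>A) \<le> 512 * \<tau>\<^sub>1 * exp (\<tau>\<^sub>2\<^sup>2) * (sq_norm D s * sq_norm D t)"
proof -
  note [measurable] = meas
  have unit: "integrable A (\<lambda>x. (dot D s x * dot D t x)\<^sup>2) \<and>
      (\<integral>x. (dot D s x * dot D t x)\<^sup>2 \<partial>A) \<le> 512 * \<tau>\<^sub>1 * exp (\<tau>\<^sub>2\<^sup>2)"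
    if s: "sq_norm D s \<le> 1" and t: "sq_norm D t \<le> 1" for s t
  proof -
    let ?g = "\<lambda>x. 128 * (exp (1 * dot D s x) + exp (- 1 * dot D s x)
      + (exp (1 * dot D t x) + exp (- 1 * dot D t x)))"
    have sgs: "integrable A (\<lambda>x. exp (l * dot D s x))"
      "(\<integral>x. exp (l * dot D s x) \<partial>A) \<le> \<tau>\<^sub>1 * exp (l\<^sup>2 * \<tau>\<^sub>2\<^sup>2)"
      "integrable A (\<lambda>x. exp (l * dot D t x))"
      "(\<integral>x. exp (l * dot D t x) \<partial>A) \<le> \<tau>\<^sub>1 * exp (l\<^sup>2 * \<tau>\<^sub>2\<^sup>2)" for l
      using sg s t unfolding subgaussian_family_def by blast+
    have g: "integrable A ?g"
      by (intro integrable_mult_right Bochner_Integration.integrable_add sgs)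
    have bound: "(dot D s x * dot D t x)\<^sup>2 \<le> ?g x" for x
    proof -
      have "2 * (dot D s x * dot D t x)\<^sup>2 \<le> dot D s x ^ 4 + dot D t x ^ 4"
        using sum_squares_bound[of "(dot D s x)\<^sup>2" "(dot D t x)\<^sup>2"]
        by (simp add: power_mult_distrib power_mult[symmetric])
      then show ?thesis
        using power4_le_exp[of "dot D s x"] power4_le_exp[of "dot D t x"] by simp
    qed
    have int: "integrable A (\<lambda>x. (dot D s x * dot D t x)\<^sup>2)"
      by (rule Bochner_Integration.integrable_bound[OF g]) (use bound in \<open>auto intro: order_trans\<close>)
    have "(\<integral>x. (dot D s x * dot D t x)\<^sup>2 \<partial>A) \<le> (\<integral>x. ?g x \<partial>A)"
      by (intro integral_mono int g bound)
    also have "\<dots> = 128 * ((\<integral>x. exp (1 * dot D s x) \<partial>A) + (\<integral>x. exp (- 1 * dot D s x) \<partial>A)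
        + ((\<integral>x. exp (1 * dot D t x) \<partial>A) + (\<integral>x. exp (- 1 * dot D t x) \<partial>A)))"
      by (intro has_bochner_integral_integral_eq has_bochner_integral_mult_right
          has_bochner_integral_add has_bochner_integral_integrable sgs)
    also have "\<dots> \<le> 512 * \<tau>\<^sub>1 * exp (\<tau>\<^sub>2\<^sup>2)"
      using sgs(2)[of 1] sgs(2)[of "-1"] sgs(4)[of 1] sgs(4)[of "-1"] by simp
    finally show ?thesis using int by blast
  qed
  \<comment> \<open>For a vanishing vector the quotient is 0 by the convention for division by 0, which is
    the right value.\<close>
  define s' where "s' = (\<lambda>c. s c / sqrt (sq_norm D s))"
  define t' where "t' = (\<lambda>c. t c / sqrt (sq_norm D t))"
  have scale: "dot D w x = sqrt (sq_norm D w) * dot D (\<lambda>c. w c / sqrt (sq_norm D w)) x" for w x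
  proof (cases "sq_norm D w = 0")
    case True
    then have "w c = 0" if "c \<in> D" for c
      using that D by (auto simp: sq_norm_def sum_nonneg_eq_0_iff)
    then show ?thesis using True by (simp add: dot_def)
  qed (simp add: dot_def sum_distrib_left)
  have norm: "sq_norm D (\<lambda>c. w c / sqrt (sq_norm D w)) \<le> 1" for w
  proof -
    have "sq_norm D (\<lambda>c. w c / sqrt (sq_norm D w)) = sq_norm D w / sq_norm D w"
      unfolding sq_norm_def[of D "\<lambda>c. w c / _"]
      by (simp add: power_divide sum_divide_distrib[symmetric] sq_norm_def[symmetric])
    then show ?thesis by simp
  qed
  have eq: "(dot D s x * dot D t x)\<^sup>2 = (sq_norm D s * sq_norm D t) * (dot D s' x * dot D t' x)\<^sup>2" for x
    by (subst scale[of s], subst scale[of t]) (simp add: s'_def t'_def power_mult_distrib mult_ac)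
  have u: "integrable A (\<lambda>x. (dot D s' x * dot D t' x)\<^sup>2)"
      "(\<integral>x. (dot D s' x * dot D t' x)\<^sup>2 \<partial>A) \<le> 512 * \<tau>\<^sub>1 * exp (\<tau>\<^sub>2\<^sup>2)"
    using unit[of s' t'] norm[of s] norm[of t] by (auto simp: s'_def t'_def)
  show "integrable A (\<lambda>x. (dot D s x * dot D t x)\<^sup>2)"
    unfolding eq by (intro integrable_mult_right u)
  show "(\<integral>x. (dot D s x * dot D t x)\<^sup>2 \<partial>A) \<le> 512 * \<tau>\<^sub>1 * exp (\<tau>\<^sub>2\<^sup>2) * (sq_norm D s * sq_norm D t)"
    unfolding eq using mult_left_mono[OF u(2), of "sq_norm D s * sq_norm D t"] by (simp add: mult_ac)
qed

section \<open>Gaussian noise and the regression score\<close>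

lemma centred_normal_moments:
  assumes "0 \<le> \<sigma>"
  shows "prob_space (centred_normal \<sigma>)" "sets (centred_normal \<sigma>) = sets borel"
    "integrable (centred_normal \<sigma>) (\<lambda>e. e)" "(\<integral>e. e \<partial>centred_normal \<sigma>) = 0"
    "integrable (centred_normal \<sigma>) (\<lambda>e. e\<^sup>2)" "(\<integral>e. e\<^sup>2 \<partial>centred_normal \<sigma>) = \<sigma>\<^sup>2"
proof -
  have "prob_space (centred_normal \<sigma>) \<and> sets (centred_normal \<sigma>) = sets borel \<and>
    integrable (centred_normal \<sigma>) (\<lambda>e. e) \<and> (\<integral>e. e \<partial>centred_normal \<sigma>) = 0 \<and>
    integrable (centred_normal \<sigma>) (\<lambda>e. e\<^sup>2) \<and> (\<integral>e. e\<^sup>2 \<partial>centred_normal \<sigma>) = \<sigma>\<^sup>2"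
  proof (cases "\<sigma> = 0")
    case True
    let ?R = "return borel (0::real)"
    have ret: "has_bochner_integral ?R f 0" if "f \<in> borel_measurable borel" "f 0 = 0" for f :: "real \<Rightarrow> real"
      using that by (simp add: has_bochner_integral_iff integrable_iff_bounded nn_integral_return integral_return)
    have m1: "has_bochner_integral ?R (\<lambda>e. e) 0"
      by (rule ret) auto
    have m2: "has_bochner_integral ?R (\<lambda>e. e\<^sup>2) 0"
      by (rule ret) auto
    have R: "prob_space ?R"
      by (rule prob_space_return) simp
    have "centred_normal \<sigma> = ?R"
      unfolding centred_normal_def using True by (rule if_P)
    with m1 m2 R True show ?thesis
      by (simp only: has_bochner_integral_iff sets_return) (simp only: power2_eq_square mult_zero_left)
  next
    case False
    then have pos: "0 < \<sigma>" using assms by simp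
    have m2: "has_bochner_integral lborel (\<lambda>x. normal_density 0 \<sigma> x * x\<^sup>2) (\<sigma>\<^sup>2)"
      using normal_moment_even[OF pos, of 0 1] by simp
    show ?thesis
      using pos normal_moment_nz_1[OF pos, of 0] m2 prob_space_normal_density[OF pos, of 0]
      by (simp add: centred_normal_def integrable_density integral_density normal_density_nonneg
          has_bochner_integral_iff)
  qed
  then show "prob_space (centred_normal \<sigma>)" "sets (centred_normal \<sigma>) = sets borel"
    "integrable (centred_normal \<sigma>) (\<lambda>e. e)" "(\<integral>e. e \<partial>centred_normal \<sigma>) = 0"
    "integrable (centred_normal \<sigma>) (\<lambda>e. e\<^sup>2)" "(\<integral>e. e\<^sup>2 \<partial>centred_normal \<sigma>) = \<sigma>\<^sup>2"
    by blast+
qed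

lemma nn_integral_square_affine_noise:
  assumes "0 \<le> \<sigma>"
  shows "(\<integral>\<^sup>+e. ennreal ((w + p * e)\<^sup>2) \<partial>centred_normal \<sigma>) = ennreal (w\<^sup>2 + p\<^sup>2 * \<sigma>\<^sup>2)"
proof -
  note N = centred_normal_moments[OF assms]
  interpret prob_space "centred_normal \<sigma>" by (rule N)
  have expand: "(w + p * e)\<^sup>2 = w\<^sup>2 + (2 * w * p) * e + p\<^sup>2 * e\<^sup>2" for e
    by (simp add: power2_eq_square algebra_simps)
  have int: "integrable (centred_normal \<sigma>) (\<lambda>e. (w + p * e)\<^sup>2)"
    unfolding expand by (simp add: N)
  have "(\<integral>\<^sup>+e. ennreal ((w + p * e)\<^sup>2) \<partial>centred_normal \<sigma>)
      = ennreal (\<integral>e. (w + p * e)\<^sup>2 \<partial>centred_normal \<sigma>)"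
    by (rule nn_integral_eq_integral[OF int]) simp
  also have "(\<integral>e. (w + p * e)\<^sup>2 \<partial>centred_normal \<sigma>) = w\<^sup>2 + p\<^sup>2 * \<sigma>\<^sup>2"
    by (simp add: expand N prob_space)
  finally show ?thesis .
qed

definition regression_score ::
    "'c set \<Rightarrow> ('c \<Rightarrow> real) \<Rightarrow> 'c \<Rightarrow> ('c \<Rightarrow> real) \<Rightarrow> real \<Rightarrow> real" where
  "regression_score D \<theta> c x e = (dot D \<theta> x + e) * x c - \<theta> c"

text \<open>
  With \<open>p = \<langle>X, s\<rangle>\<close> and \<open>g = p \<langle>X, \<theta>\<rangle>\<close>, the linear form \<open>\<langle>Z, s\<rangle>\<close> equals
  \<open>g - E g + p \<epsilon>\<close>, because \<open>E g = \<langle>s, \<theta>\<rangle>\<close>. Integrating out the noise and then the design leaves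
  \<open>u\<^sup>2 + Var g + \<sigma>\<^sup>2 \<parallel>s\<parallel>\<^sup>2\<close>, and \<open>Var g \<le> E g\<^sup>2\<close> is a mixed fourth moment.
\<close>

lemma centred_scores_regression:
  assumes \<mu>: "standardized \<mu>" and D: "finite D" and \<sigma>: "0 \<le> \<sigma>"
    and sg: "subgaussian_family D (PiM D (\<lambda>_. \<mu>)) \<tau>\<^sub>1 \<tau>\<^sub>2"
    and \<beta>: "512 * \<tau>\<^sub>1 * exp (\<tau>\<^sub>2\<^sup>2) * sq_norm D \<theta> + \<sigma>\<^sup>2 \<le> \<beta>" and \<beta>0: "0 \<le> \<beta>"
  shows "centred_scores (PiM D (\<lambda>_. \<mu>)) (centred_normal \<sigma>) D (regression_score D \<theta>) \<beta>"
proof -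
  let ?A = "PiM D (\<lambda>_. \<mu>)" and ?B = "centred_normal \<sigma>"
  have pm: "prob_space \<mu>" and sets_\<mu>: "sets \<mu> = sets borel"
    using \<mu> by (auto simp: standardized_def)
  note N = centred_normal_moments[OF \<sigma>]
  interpret A: prob_space ?A by (intro prob_space_PiM pm)
  interpret B: prob_space ?B by (rule N)
  note meas = borel_measurable_dot[OF sets_\<mu>]
  have comp: "(\<lambda>x. x c) \<in> borel_measurable ?A" if "c \<in> D" for c
    using measurable_component_singleton[OF that, of "\<lambda>_. \<mu>"] sets_\<mu>
    by (simp cong: measurable_cong_sets)
  have noise: "(\<lambda>q. snd q) \<in> borel_measurable (?A \<Otimes>\<^sub>M ?B)"
    using measurable_snd[of ?A ?B] N(2) by (simp cong: measurable_cong_sets)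
  have score_meas: "(\<lambda>q. regression_score D \<theta> c (fst q) (snd q)) \<in> borel_measurable (?A \<Otimes>\<^sub>M ?B)"
    if "c \<in> D" for c
    unfolding regression_score_def
    by (intro borel_measurable_diff borel_measurable_times borel_measurable_add noise
        measurable_compose[OF measurable_fst meas] measurable_compose[OF measurable_fst comp[OF that]]) auto
  have bound: "(\<integral>\<^sup>+q. ennreal ((u + (\<Sum>c\<in>D. s c * regression_score D \<theta> c (fst q) (snd q)))\<^sup>2) \<partial>(?A \<Otimes>\<^sub>M ?B))
      \<le> ennreal (u\<^sup>2 + \<beta> * (\<Sum>c\<in>D. (s c)\<^sup>2))" for u s
  proof -
    define p where "p = dot D s"
    define g where "g = (\<lambda>x. p x * dot D \<theta> x)"
    define m where "m = dot D s \<theta>"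
    have lin: "(\<Sum>c\<in>D. s c * regression_score D \<theta> c x e) = (dot D \<theta> x + e) * p x - m" for x e
      by (simp add: regression_score_def p_def m_def dot_def[of D s] right_diff_distrib
          sum_subtractf sum_distrib_left mult_ac)
    have g_int: "integrable ?A g" "(\<integral>x. g x \<partial>?A) = m"
      using dot_product_moments[OF \<mu> D, of s \<theta>] by (auto simp: g_def p_def m_def)
    have p2: "integrable ?A (\<lambda>x. (p x)\<^sup>2)" "(\<integral>x. (p x)\<^sup>2 \<partial>?A) = sq_norm D s"
      using dot_product_moments[OF \<mu> D, of s s]
      by (auto simp: p_def dot_def[of D s s] sq_norm_def power2_eq_square)
    have g2: "integrable ?A (\<lambda>x. (g x)\<^sup>2)"
      "(\<integral>x. (g x)\<^sup>2 \<partial>?A) \<le> 512 * \<tau>\<^sub>1 * exp (\<tau>\<^sub>2\<^sup>2) * (sq_norm D s * sq_norm D \<theta>)"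
      using subgaussian_fourth_moment[OF sg D meas, of s \<theta>] by (auto simp: g_def p_def)
    have expand: "(u + (g x - m))\<^sup>2 + (p x)\<^sup>2 * \<sigma>\<^sup>2
        = (u - m)\<^sup>2 + (2 * (u - m)) * g x + (g x)\<^sup>2 + \<sigma>\<^sup>2 * (p x)\<^sup>2" for x
      by (simp add: power2_eq_square algebra_simps)
    have int: "integrable ?A (\<lambda>x. (u + (g x - m))\<^sup>2 + (p x)\<^sup>2 * \<sigma>\<^sup>2)"
      unfolding expand by (simp add: g_int g2 p2)
    have "(\<integral>\<^sup>+q. ennreal ((u + (\<Sum>c\<in>D. s c * regression_score D \<theta> c (fst q) (snd q)))\<^sup>2) \<partial>(?A \<Otimes>\<^sub>M ?B))
        = (\<integral>\<^sup>+x. \<integral>\<^sup>+e. ennreal ((u + (\<Sum>c\<in>D. s c * regression_score D \<theta> c x e))\<^sup>2) \<partial>?B \<partial>?A)"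
      using score_meas by (subst B.nn_integral_fst[symmetric]) auto
    also have "\<dots> = (\<integral>\<^sup>+x. \<integral>\<^sup>+e. ennreal (((u + (g x - m)) + p x * e)\<^sup>2) \<partial>?B \<partial>?A)"
      by (simp add: lin g_def algebra_simps)
    also have "\<dots> = (\<integral>\<^sup>+x. ennreal ((u + (g x - m))\<^sup>2 + (p x)\<^sup>2 * \<sigma>\<^sup>2) \<partial>?A)"
      by (simp only: nn_integral_square_affine_noise[OF \<sigma>])
    also have "\<dots> = ennreal (\<integral>x. (u + (g x - m))\<^sup>2 + (p x)\<^sup>2 * \<sigma>\<^sup>2 \<partial>?A)"
      by (rule nn_integral_eq_integral[OF int]) simp
    also have "(\<integral>x. (u + (g x - m))\<^sup>2 + (p x)\<^sup>2 * \<sigma>\<^sup>2 \<partial>?A)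
        = (u - m)\<^sup>2 + 2 * (u - m) * m + (\<integral>x. (g x)\<^sup>2 \<partial>?A) + \<sigma>\<^sup>2 * sq_norm D s"
      unfolding expand by (simp add: g_int g2(1) p2 A.prob_space)
    also have "\<dots> \<le> u\<^sup>2 + (512 * \<tau>\<^sub>1 * exp (\<tau>\<^sub>2\<^sup>2) * sq_norm D \<theta> + \<sigma>\<^sup>2) * sq_norm D s"
    proof -
      have "(u - m)\<^sup>2 + 2 * (u - m) * m = u\<^sup>2 - m\<^sup>2"
        by (simp add: power2_eq_square algebra_simps)
      also have "\<dots> \<le> u\<^sup>2" by simp
      finally show ?thesis using g2(2) by (simp add: algebra_simps)
    qed
    also have "\<dots> \<le> u\<^sup>2 + \<beta> * sq_norm D s"
      using mult_right_mono[OF \<beta>, of "sq_norm D s"] by simp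
    finally show ?thesis
      by (simp add: sq_norm_def ennreal_leI)
  qed
  show ?thesis
    by unfold_locales (use D \<beta>0 score_meas bound in auto)
qed

section \<open>From matrices to families of entries\<close>

text \<open>
  The trace pairs \<open>X\<close> with the transpose of \<open>M\<close>; for symmetric \<open>M\<close> the transposition disappears.
\<close>

lemma mat_trace_design_mult:
  assumes "M \<in> carrier_mat d d"
  shows "mat_trace (design_mat d x * M) = dot ({..<d} \<times> {..<d}) (\<lambda>(m, k). M $$ (k, m)) x"
proof -
  have "mat_trace (design_mat d x * M) = (\<Sum>m<d. \<Sum>k<d. x (m, k) * M $$ (k, m))"
    using assms by (simp add: mat_trace_def design_mat_def scalar_prod_def atLeast0LessThan)
  also have "\<dots> = (\<Sum>c\<in>{..<d} \<times> {..<d}. x c * M $$ (snd c, fst c))"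
    by (simp add: sum.cartesian_product split_beta')
  finally show ?thesis
    by (simp add: dot_def split_beta' mult.commute)
qed

lemma frob_norm_eq_sq_norm:
  assumes "M \<in> carrier_mat d d"
  shows "(frob_norm M)\<^sup>2 = sq_norm ({..<d} \<times> {..<d}) (\<lambda>c. M $$ c)"
  using assms
  by (simp add: frob_norm_def sq_norm_def sum.cartesian_product sum_nonneg)

lemma frob_norm_diff:
  assumes "A \<in> carrier_mat d d" "B \<in> carrier_mat d d"
  shows "(frob_norm (A - B))\<^sup>2 = (\<Sum>c\<in>{..<d} \<times> {..<d}. (A $$ c - B $$ c)\<^sup>2)"
proof -
  have "A - B \<in> carrier_mat d d" by (rule minus_carrier_mat[OF assms(2)])
  from frob_norm_eq_sq_norm[OF this] show ?thesis
    using assms by (auto simp: sq_norm_def intro!: sum.cong)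
qed

lemma subgaussian_design_imp_family:
  assumes "subgaussian_design d \<mu> \<tau>\<^sub>1 \<tau>\<^sub>2"
  shows "subgaussian_family ({..<d} \<times> {..<d}) (PiM ({..<d} \<times> {..<d}) (\<lambda>_. \<mu>)) \<tau>\<^sub>1 \<tau>\<^sub>2"
  unfolding subgaussian_family_def
proof (intro allI impI)
  let ?D = "{..<d} \<times> {..<d}"
  fix s :: "nat \<times> nat \<Rightarrow> real" and l :: real
  assume s: "sq_norm ?D s \<le> 1"
  define M where "M = Matrix.mat d d (\<lambda>(k, m). s (m, k))"
  have M: "M \<in> carrier_mat d d" by (simp add: M_def)
  have "(frob_norm M)\<^sup>2 = (\<Sum>k<d. \<Sum>m<d. (s (m, k))\<^sup>2)"
    by (simp add: frob_norm_def M_def sum_nonneg)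
  also have "\<dots> = sq_norm ?D s"
    by (subst sum.swap) (simp add: sq_norm_def sum.cartesian_product)
  finally have "(frob_norm M)\<^sup>2 \<le> 1\<^sup>2" using s by simp
  then have norm: "frob_norm M \<le> 1" by (rule power2_le_imp_le) simp
  have "mat_trace (design_mat d x * M) = dot ?D s x" for x
    unfolding mat_trace_design_mult[OF M]
    by (auto simp: dot_def M_def intro!: sum.cong)
  then show "integrable (PiM ?D (\<lambda>_. \<mu>)) (\<lambda>x. exp (l * dot ?D s x)) \<and>
      (\<integral>x. exp (l * dot ?D s x) \<partial>PiM ?D (\<lambda>_. \<mu>)) \<le> \<tau>\<^sub>1 * exp (l\<^sup>2 * \<tau>\<^sub>2\<^sup>2)"
    using assms M norm unfolding subgaussian_design_def entries_law_def by auto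
qed

section \<open>The U-statistic as a sum over centred scores\<close>

text \<open>
  Every index lies in \<open>n - 1\<close> pairs and there are \<open>n (n - 1) / 2\<close> pairs, hence the coefficients.
\<close>

lemma pair_sum_shift:
  fixes z :: "nat \<Rightarrow> 'c \<Rightarrow> real"
  shows "(\<Sum>j<n. \<Sum>i<j. \<Sum>c\<in>D. (z i c + \<delta> c) * (z j c + \<delta> c)) =
    (\<Sum>j<n. \<Sum>i<j. \<Sum>c\<in>D. z i c * z j c)
    + (real n - 1) * (\<Sum>i<n. \<Sum>c\<in>D. \<delta> c * z i c)
    + real n * (real n - 1) / 2 * (\<Sum>c\<in>D. (\<delta> c)\<^sup>2)"
proof (induction n)
  case 0
  show ?case by simp
next
  case (Suc n)
  have "(\<Sum>i<n. \<Sum>c\<in>D. (z i c + \<delta> c) * (z n c + \<delta> c)) =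
    (\<Sum>i<n. \<Sum>c\<in>D. z i c * z n c) + (\<Sum>i<n. \<Sum>c\<in>D. \<delta> c * z i c)
    + real n * (\<Sum>c\<in>D. \<delta> c * z n c) + real n * (\<Sum>c\<in>D. (\<delta> c)\<^sup>2)"
    by (simp add: ring_distribs mult.commute sum.distrib power2_eq_square)
  moreover have "a + (real n - 1) * L + real n * (real n - 1) / 2 * q + (b + L + real n * l + real n * q)
      = a + b + (1 + real n - 1) * (L + l) + (1 + real n) * (1 + real n - 1) / 2 * q" for a b L l q
    by (simp add: field_simps)
  ultimately show ?case
    by (simp only: sum.lessThan_Suc Suc.IH of_nat_Suc)
qed

text \<open>
  Symmetry of \<open>\<theta>\<close> is what makes the scores centred at \<open>\<theta>\<close> itself: the response depends on the
  transpose of \<open>\<theta>\<close>, while the U-statistic compares with the entries of \<open>\<theta>'\<close> in place.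
\<close>

lemma U_stat_decomposition:
  fixes X :: "nat \<Rightarrow> nat \<times> nat \<Rightarrow> real" and \<epsilon> :: "nat \<Rightarrow> real"
  assumes n: "2 \<le> n" and \<theta>: "\<theta> \<in> sym_mats d" and \<theta>': "\<theta>' \<in> carrier_mat d d"
  defines "D \<equiv> {..<d} \<times> {..<d}"
    and "score \<equiv> \<lambda>i c. regression_score ({..<d} \<times> {..<d}) (\<lambda>c. \<theta> $$ c) c (X i) (\<epsilon> i)"
  shows "U_stat n d \<theta>' (response n d \<theta> X \<epsilon>) X = (frob_norm (\<theta> - \<theta>'))\<^sup>2
     + (2 / (n * (real n - 1)) * (\<Sum>j<n. \<Sum>i<j. \<Sum>c\<in>D. score i c * score j c)
        + 2 / n * (\<Sum>i<n. \<Sum>c\<in>D. (\<theta> $$ c - \<theta>' $$ c) * score i c))"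
proof -
  have \<theta>c: "\<theta> \<in> carrier_mat d d" and tr: "transpose_mat \<theta> = \<theta>"
    using \<theta> by (auto simp: sym_mats_def)
  have sym: "\<theta> $$ (k, m) = \<theta> $$ (m, k)" if "k < d" "m < d" for k m
  proof -
    have "transpose_mat \<theta> $$ (k, m) = \<theta> $$ (m, k)"
      using \<theta>c that by simp
    then show ?thesis by (simp add: tr)
  qed
  have resp: "response n d \<theta> X \<epsilon> i = dot D (\<lambda>c. \<theta> $$ c) (X i) + \<epsilon> i" if "i < n" for i
    using that sym unfolding response_def D_def
    by (auto simp: mat_trace_design_mult[OF \<theta>c] dot_def intro!: sum.cong)
  have residual: "response n d \<theta> X \<epsilon> i * X i c - \<theta>' $$ c = score i c + (\<theta> $$ c - \<theta>' $$ c)"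
    if "i < n" for i c
    using that by (simp add: resp score_def regression_score_def D_def)
  have "(\<Sum>j<n. \<Sum>i<j. \<Sum>m<d. \<Sum>k<d.
        (response n d \<theta> X \<epsilon> i * X i (m, k) - \<theta>' $$ (m, k)) * (response n d \<theta> X \<epsilon> j * X j (m, k) - \<theta>' $$ (m, k)))
      = (\<Sum>j<n. \<Sum>i<j. \<Sum>c\<in>D. (score i c + (\<theta> $$ c - \<theta>' $$ c)) * (score j c + (\<theta> $$ c - \<theta>' $$ c)))"
  proof (intro sum.cong refl)
    fix j i assume "j \<in> {..<n}" "i \<in> {..<j}"
    then have ij: "i < n" "j < n" by auto
    show "(\<Sum>m<d. \<Sum>k<d. (response n d \<theta> X \<epsilon> i * X i (m, k) - \<theta>' $$ (m, k))
          * (response n d \<theta> X \<epsilon> j * X j (m, k) - \<theta>' $$ (m, k)))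
        = (\<Sum>c\<in>D. (score i c + (\<theta> $$ c - \<theta>' $$ c)) * (score j c + (\<theta> $$ c - \<theta>' $$ c)))"
      unfolding residual[OF ij(1)] residual[OF ij(2)] D_def
      by (simp add: sum.cartesian_product split_beta')
  qed
  also note pair_sum_shift
  finally have sums: "(\<Sum>j<n. \<Sum>i<j. \<Sum>m<d. \<Sum>k<d.
        (response n d \<theta> X \<epsilon> i * X i (m, k) - \<theta>' $$ (m, k)) * (response n d \<theta> X \<epsilon> j * X j (m, k) - \<theta>' $$ (m, k))) =
      (\<Sum>j<n. \<Sum>i<j. \<Sum>c\<in>D. score i c * score j c)
    + (real n - 1) * (\<Sum>i<n. \<Sum>c\<in>D. (\<theta> $$ c - \<theta>' $$ c) * score i c)
    + real n * (real n - 1) / 2 * (\<Sum>c\<in>D. (\<theta> $$ c - \<theta>' $$ c)\<^sup>2)" .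
  have norm: "(frob_norm (\<theta> - \<theta>'))\<^sup>2 = (\<Sum>c\<in>D. (\<theta> $$ c - \<theta>' $$ c)\<^sup>2)"
    unfolding D_def by (rule frob_norm_diff[OF \<theta>c \<theta>'])
  have pos: "0 < real n" "0 < real n - 1" using n by auto
  have "2 / (real n * (real n - 1)) * (v + (real n - 1) * l + real n * (real n - 1) / 2 * q)
      = q + (2 / (n * (real n - 1)) * v + 2 / n * l)" for v l q
    using pos by (simp add: distrib_left)
  then show ?thesis
    unfolding U_stat_def sums norm by (simp only:)
qed

section \<open>Measurability of the data and of the U-statistic\<close>

lemma sets_design_noise:
  assumes "sets \<mu> = sets borel" "0 \<le> \<sigma>"
  shows "sets (design_law n d \<mu> \<Otimes>\<^sub>M noise_law n \<sigma>)
    = sets (PiM {..<n} (\<lambda>_. PiM ({..<d} \<times> {..<d}) (\<lambda>_. borel)) \<Otimes>\<^sub>M PiM {..<n} (\<lambda>_. borel))"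
  unfolding design_law_def noise_law_def entries_law_def
  by (intro sets_pair_measure_cong sets_PiM_cong refl assms centred_normal_moments)

lemma data_map_measurable:
  assumes \<mu>: "sets \<mu> = sets borel" and \<sigma>: "0 \<le> \<sigma>" and \<theta>: "\<theta> \<in> carrier_mat d d"
  shows "(\<lambda>(X, \<epsilon>). (response n d \<theta> X \<epsilon>, X)) \<in> design_law n d \<mu> \<Otimes>\<^sub>M noise_law n \<sigma> \<rightarrow>\<^sub>M
    PiM {..<n} (\<lambda>_. borel) \<Otimes>\<^sub>M PiM {..<n} (\<lambda>_. PiM ({..<d} \<times> {..<d}) (\<lambda>_. borel))"
proof -
  let ?D = "{..<d} \<times> {..<d}"
  let ?N = "PiM {..<n} (\<lambda>_. PiM ?D (\<lambda>_. borel)) \<Otimes>\<^sub>M PiM {..<n} (\<lambda>_. borel :: real measure)"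
  have X: "(\<lambda>p. fst p i) \<in> ?N \<rightarrow>\<^sub>M PiM ?D (\<lambda>_. borel)" if "i < n" for i
    using that by (intro measurable_compose[OF measurable_fst measurable_component_singleton]) auto
  have E: "(\<lambda>p. snd p i) \<in> ?N \<rightarrow>\<^sub>M borel" if "i < n" for i
    using that by (intro measurable_compose[OF measurable_snd measurable_component_singleton]) auto
  have "(\<lambda>p. response n d \<theta> (fst p) (snd p)) \<in> ?N \<rightarrow>\<^sub>M PiM {..<n} (\<lambda>_. borel)"
    unfolding response_def mat_trace_design_mult[OF \<theta>]
    by (intro measurable_restrict borel_measurable_add E measurable_compose[OF X borel_measurable_dot]) auto
  then have "(\<lambda>p. (response n d \<theta> (fst p) (snd p), fst p)) \<in> ?N \<rightarrow>\<^sub>M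
    PiM {..<n} (\<lambda>_. borel) \<Otimes>\<^sub>M PiM {..<n} (\<lambda>_. PiM ?D (\<lambda>_. borel))"
    by (intro measurable_Pair measurable_fst)
  then show ?thesis
    by (simp add: split_beta' measurable_cong_sets[OF sets_design_noise[OF \<mu> \<sigma>] refl])
qed

lemma U_stat_measurable:
  "(\<lambda>(Y, X). U_stat n d \<theta>' Y X) \<in>
    borel_measurable (PiM {..<n} (\<lambda>_. borel) \<Otimes>\<^sub>M PiM {..<n} (\<lambda>_. PiM ({..<d} \<times> {..<d}) (\<lambda>_. borel)))"
proof -
  let ?D = "{..<d} \<times> {..<d}"
  let ?N = "PiM {..<n} (\<lambda>_. borel :: real measure) \<Otimes>\<^sub>M PiM {..<n} (\<lambda>_. PiM ?D (\<lambda>_. borel))"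
  have Y: "(\<lambda>p. fst p i) \<in> borel_measurable ?N" if "i < n" for i
    using that by (intro measurable_compose[OF measurable_fst measurable_component_singleton]) auto
  have X: "(\<lambda>p. snd p i c) \<in> borel_measurable ?N" if "i < n" "c \<in> ?D" for i c
  proof -
    have "(\<lambda>p. snd p i) \<in> ?N \<rightarrow>\<^sub>M PiM ?D (\<lambda>_. borel)"
      using that by (intro measurable_compose[OF measurable_snd measurable_component_singleton]) auto
    from measurable_compose[OF this measurable_component_singleton[OF that(2)]] show ?thesis .
  qed
  show ?thesis
    unfolding U_stat_def split_beta'
    by (intro borel_measurable_times borel_measurable_sum borel_measurable_diff Y X) auto
qed

section \<open>Coverage\<close>

text \<open>
  Coverage for explicit thresholds, under the conditions on \<open>z\<^sub>1\<close> and \<open>z\<^sub>2\<close> that Chebyshev's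
  inequality asks for. The event of the data law is pulled back to the product of the design and
  noise laws, on which the scores live.
\<close>

lemma coverage:
  assumes n: "2 \<le> n" and \<mu>: "standardized \<mu>" and sg: "subgaussian_design d \<mu> \<tau>\<^sub>1 \<tau>\<^sub>2"
    and \<sigma>: "0 \<le> \<sigma>" and \<theta>: "\<theta> \<in> sym_mats d" and \<theta>': "\<theta>' \<in> carrier_mat d d"
    and \<beta>: "512 * \<tau>\<^sub>1 * exp (\<tau>\<^sub>2\<^sup>2) * (frob_norm \<theta>)\<^sup>2 + \<sigma>\<^sup>2 \<le> \<beta>" and \<beta>0: "0 \<le> \<beta>"
    and z: "0 \<le> z\<^sub>1" "0 \<le> z\<^sub>2" and \<alpha>: "0 \<le> \<alpha>"
    and z1: "4 * (\<beta> * (frob_norm (\<theta> - \<theta>'))\<^sup>2) / n \<le> \<alpha> / 2 * z\<^sub>1\<^sup>2"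
    and z2: "2 * (\<beta>\<^sup>2 * (real d)\<^sup>2) / (n * (real n - 1)) \<le> \<alpha> / 2 * z\<^sub>2\<^sup>2"
    and zs: "z\<^sub>1 + z\<^sub>2 \<le> z"
  shows "1 - \<alpha> \<le> measure (data_law n d \<mu> \<sigma> \<theta>)
    {(Y, X) \<in> space (data_law n d \<mu> \<sigma> \<theta>). \<theta> \<in> conf_set n d \<theta>' z Y X}"
proof -
  let ?D = "{..<d} \<times> {..<d}"
  let ?P = "design_law n d \<mu> \<Otimes>\<^sub>M noise_law n \<sigma>"
  let ?N = "PiM {..<n} (\<lambda>_. borel :: real measure) \<Otimes>\<^sub>M PiM {..<n} (\<lambda>_. PiM ?D (\<lambda>_. borel))"
  let ?T = "\<lambda>(X, \<epsilon>). (response n d \<theta> X \<epsilon>, X)"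
  let ?S = "{(Y, X) \<in> space ?N. \<theta> \<in> conf_set n d \<theta>' z Y X}"
  have \<theta>c: "\<theta> \<in> carrier_mat d d" using \<theta> by (simp add: sym_mats_def)
  have sets_\<mu>: "sets \<mu> = sets borel" using \<mu> by (simp add: standardized_def)
  interpret centred_scores "PiM ?D (\<lambda>_. \<mu>)" "centred_normal \<sigma>" ?D
      "regression_score ?D (\<lambda>c. \<theta> $$ c)" \<beta>
    using \<beta> \<beta>0 by (intro centred_scores_regression[OF \<mu> _ \<sigma> subgaussian_design_imp_family[OF sg]])
      (auto simp: frob_norm_eq_sq_norm[OF \<theta>c])
  have P: "?P = sample n"
    by (simp add: design_law_def noise_law_def entries_law_def)
  interpret P: prob_space ?P unfolding P by (rule prob_space_sample)
  let ?W = "\<lambda>p. 2 / (n * (real n - 1)) * (\<Sum>j<n. \<Sum>i<j. \<Sum>c\<in>?D. score p i c * score p j c)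
      + 2 / n * (\<Sum>i<n. \<Sum>c\<in>?D. (\<theta> $$ c - \<theta>' $$ c) * score p i c)"
  have W: "?W \<in> borel_measurable ?P"
    unfolding P by (intro borel_measurable_add borel_measurable_times borel_measurable_sum measurable_score) auto
  have S: "?S \<in> sets ?N"
  proof -
    have "?S = {p \<in> space ?N. (frob_norm (\<theta> - \<theta>'))\<^sup>2 \<le> (\<lambda>(Y, X). U_stat n d \<theta>' Y X) p + z}"
      using \<theta> by (auto simp: conf_set_def)
    then show ?thesis
      using U_stat_measurable[of n d \<theta>'] by simp
  qed
  have T: "?T \<in> ?P \<rightarrow>\<^sub>M ?N"
    by (rule data_map_measurable[OF sets_\<mu> \<sigma> \<theta>c])
  have norm: "(frob_norm (\<theta> - \<theta>'))\<^sup>2 = (\<Sum>c\<in>?D. (\<theta> $$ c - \<theta>' $$ c)\<^sup>2)"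
    by (rule frob_norm_diff[OF \<theta>c \<theta>'])
  have "P.prob {p \<in> space ?P. ?W p < - (z\<^sub>1 + z\<^sub>2)} \<le> \<alpha>"
    unfolding P
    by (rule prob_pair_plus_linear_le[OF n z \<alpha>])
       (use z1[unfolded norm] z2 in \<open>simp_all add: card_cartesian_product power2_eq_square\<close>)
  moreover have "P.prob {p \<in> space ?P. \<not> ?W p < - (z\<^sub>1 + z\<^sub>2)} = 1 - P.prob {p \<in> space ?P. ?W p < - (z\<^sub>1 + z\<^sub>2)}"
    by (rule P.prob_neg) (use W in measurable)
  moreover have "P.prob {p \<in> space ?P. \<not> ?W p < - (z\<^sub>1 + z\<^sub>2)} \<le> P.prob (?T -` ?S \<inter> space ?P)"
  proof (rule P.finite_measure_mono, rule subsetI)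
    fix p assume p: "p \<in> {p \<in> space ?P. \<not> ?W p < - (z\<^sub>1 + z\<^sub>2)}"
    obtain X \<epsilon> where p_eq: "p = (X, \<epsilon>)" by (cases p)
    have "- z \<le> ?W p" using p zs by auto
    then have "\<theta> \<in> conf_set n d \<theta>' z (response n d \<theta> X \<epsilon>) X"
      using \<theta> by (simp add: conf_set_def p_eq U_stat_decomposition[OF n \<theta> \<theta>'])
    moreover have "?T p \<in> space ?N"
      using p by (intro measurable_space[OF T]) auto
    ultimately show "p \<in> ?T -` ?S \<inter> space ?P"
      using p by (auto simp: p_eq)
  next
    show "?T -` ?S \<inter> space ?P \<in> sets ?P"
      using T S by (rule measurable_sets)
  qed
  moreover have "measure (data_law n d \<mu> \<sigma> \<theta>)
      {(Y, X) \<in> space (data_law n d \<mu> \<sigma> \<theta>). \<theta> \<in> conf_set n d \<theta>' z Y X} = P.prob (?T -` ?S \<inter> space ?P)"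
    unfolding data_law_def space_distr by (rule measure_distr[OF T S])
  ultimately show ?thesis by linarith
qed

theorem theorem3:
  fixes v \<tau>\<^sub>1 \<tau>\<^sub>2 r :: real
  assumes "\<tau>\<^sub>1 > 0" and "\<tau>\<^sub>2 > 0" and "r > 0"
  shows "\<exists>\<zeta>\<^sub>1 \<zeta>\<^sub>2 :: real \<Rightarrow> real.
    \<zeta>\<^sub>1 \<in> O[at_right 0](\<lambda>\<alpha>. sqrt (1 / \<alpha>)) \<and>
    \<zeta>\<^sub>2 \<in> O[at_right 0](\<lambda>\<alpha>. sqrt (1 / \<alpha>)) \<and>
    (\<forall>\<alpha>>0. \<forall>d n \<mu> \<sigma> \<theta> \<theta>' C\<^sub>1 C\<^sub>2.
       n \<ge> 2 \<longrightarrow>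
       standardized \<mu> \<longrightarrow>
       subgaussian_design d \<mu> \<tau>\<^sub>1 \<tau>\<^sub>2 \<longrightarrow>
       0 \<le> \<sigma> \<longrightarrow> \<sigma>\<^sup>2 \<le> v \<longrightarrow>
       \<theta> \<in> sym_mats d \<longrightarrow>
       \<sigma> = 0 \<or> r \<le> frob_norm \<theta> \<longrightarrow>
       \<theta>' \<in> carrier_mat d d \<longrightarrow>
       \<zeta>\<^sub>1 \<alpha> * frob_norm \<theta> \<le> C\<^sub>1 \<longrightarrow>
       \<zeta>\<^sub>2 \<alpha> * (frob_norm \<theta>)\<^sup>2 \<le> C\<^sub>2 \<longrightarrow>
       measure (data_law n d \<mu> \<sigma> \<theta>)
         {(Y, X) \<in> space (data_law n d \<mu> \<sigma> \<theta>).
            \<theta> \<in> conf_set n d \<theta>' (z_term n d C\<^sub>1 C\<^sub>2 \<theta> \<theta>') Y X} \<ge> 1 - \<alpha>)"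
proof -
  \<comment> \<open>\<open>K \<parallel>\<theta>\<parallel>\<^sup>2\<close> bounds the variance of a score in every unit direction; \<open>\<bar>v\<bar>\<close> makes \<open>K\<close>
    nonnegative for every \<open>v\<close>.\<close>
  define K where "K = 512 * \<tau>\<^sub>1 * exp (\<tau>\<^sub>2\<^sup>2) + \<bar>v\<bar> / r\<^sup>2"
  have K: "0 \<le> K" using assms by (simp add: K_def)
  \<comment> \<open>The factors are fixed by \<open>\<alpha> \<zeta>\<^sub>1\<^sup>2 = 8 K\<close> and \<open>\<alpha> \<zeta>\<^sub>2\<^sup>2 = 8 K\<^sup>2\<close>. For \<open>\<zeta>\<^sub>2\<close> this absorbs
    \<open>n / (n - 1) \<le> 2\<close>.\<close>
  define \<zeta>\<^sub>1 where "\<zeta>\<^sub>1 = (\<lambda>\<alpha>::real. sqrt (8 * K) * sqrt (1 / \<alpha>))"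
  define \<zeta>\<^sub>2 where "\<zeta>\<^sub>2 = (\<lambda>\<alpha>::real. (sqrt 8 * K) * sqrt (1 / \<alpha>))"
  show ?thesis
  proof (rule exI[of _ \<zeta>\<^sub>1], rule exI[of _ \<zeta>\<^sub>2], intro conjI allI impI)
    show "\<zeta>\<^sub>1 \<in> O[at_right 0](\<lambda>\<alpha>. sqrt (1 / \<alpha>))"
      unfolding \<zeta>\<^sub>1_def by simp
  next
    show "\<zeta>\<^sub>2 \<in> O[at_right 0](\<lambda>\<alpha>. sqrt (1 / \<alpha>))"
      unfolding \<zeta>\<^sub>2_def by simp
  next
    fix \<alpha> :: real and d n :: nat and \<mu> :: "real measure" and \<sigma> :: real and \<theta> \<theta>' :: "real mat" and C\<^sub>1 C\<^sub>2 :: real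
    assume \<alpha>: "0 < \<alpha>" and n: "2 \<le> n" and \<mu>: "standardized \<mu>" and sg: "subgaussian_design d \<mu> \<tau>\<^sub>1 \<tau>\<^sub>2"
      and \<sigma>: "0 \<le> \<sigma>" "\<sigma>\<^sup>2 \<le> v" and \<theta>: "\<theta> \<in> sym_mats d" and large: "\<sigma> = 0 \<or> r \<le> frob_norm \<theta>"
      and \<theta>': "\<theta>' \<in> carrier_mat d d"
      and C: "\<zeta>\<^sub>1 \<alpha> * frob_norm \<theta> \<le> C\<^sub>1" "\<zeta>\<^sub>2 \<alpha> * (frob_norm \<theta>)\<^sup>2 \<le> C\<^sub>2"
    let ?F = "frob_norm \<theta>" and ?G = "frob_norm (\<theta> - \<theta>')"
    have F: "0 \<le> ?F" and G: "0 \<le> ?G"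
      by (simp_all add: frob_norm_def sum_nonneg)
    have pos: "0 < real n" "0 < real n - 1" using n by auto
    have \<zeta>: "0 \<le> \<zeta>\<^sub>1 \<alpha>" "0 \<le> \<zeta>\<^sub>2 \<alpha>" "\<alpha> * (\<zeta>\<^sub>1 \<alpha>)\<^sup>2 = 8 * K" "\<alpha> * (\<zeta>\<^sub>2 \<alpha>)\<^sup>2 = 8 * K\<^sup>2"
      using K \<alpha> by (simp_all add: \<zeta>\<^sub>1_def \<zeta>\<^sub>2_def power_mult_distrib)
    have noise: "\<sigma>\<^sup>2 \<le> \<bar>v\<bar> / r\<^sup>2 * ?F\<^sup>2"
    proof (cases "\<sigma> = 0")
      case False
      then have "r\<^sup>2 \<le> ?F\<^sup>2" using large assms by (intro power_mono) auto
      then have "\<bar>v\<bar> / r\<^sup>2 * r\<^sup>2 \<le> \<bar>v\<bar> / r\<^sup>2 * ?F\<^sup>2" by (intro mult_left_mono) auto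
      then show ?thesis using \<sigma> assms by simp
    qed simp
    show "1 - \<alpha> \<le> measure (data_law n d \<mu> \<sigma> \<theta>)
         {(Y, X) \<in> space (data_law n d \<mu> \<sigma> \<theta>).
            \<theta> \<in> conf_set n d \<theta>' (z_term n d C\<^sub>1 C\<^sub>2 \<theta> \<theta>') Y X}"
    proof (rule coverage[OF n \<mu> sg \<sigma>(1) \<theta> \<theta>', where \<beta> = "K * ?F\<^sup>2"
          and z\<^sub>1 = "\<zeta>\<^sub>1 \<alpha> * ?F * ?G / sqrt n" and z\<^sub>2 = "\<zeta>\<^sub>2 \<alpha> * ?F\<^sup>2 * d / n"])
      show "512 * \<tau>\<^sub>1 * exp (\<tau>\<^sub>2\<^sup>2) * ?F\<^sup>2 + \<sigma>\<^sup>2 \<le> K * ?F\<^sup>2"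
        using noise by (simp add: K_def distrib_right)
      have "\<alpha> / 2 * (\<zeta>\<^sub>1 \<alpha> * ?F * ?G / sqrt n)\<^sup>2 = (\<alpha> * (\<zeta>\<^sub>1 \<alpha>)\<^sup>2) * ?F\<^sup>2 * ?G\<^sup>2 / (2 * n)"
        by (simp add: power_mult_distrib power_divide)
      also have "\<dots> = 4 * (K * ?F\<^sup>2 * ?G\<^sup>2) / n"
        using \<zeta>(3) by simp
      finally show "4 * (K * ?F\<^sup>2 * ?G\<^sup>2) / n \<le> \<alpha> / 2 * (\<zeta>\<^sub>1 \<alpha> * ?F * ?G / sqrt n)\<^sup>2"
        by simp
      have "2 * ((K * ?F\<^sup>2)\<^sup>2 * (real d)\<^sup>2) / (n * (real n - 1)) \<le> 4 * ((K * ?F\<^sup>2)\<^sup>2 * (real d)\<^sup>2) / (real n)\<^sup>2"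
      proof -
        have "1 / (n * (real n - 1)) \<le> 2 / (real n)\<^sup>2"
          using pos n by (simp add: divide_simps power2_eq_square)
        then have "2 * ((K * ?F\<^sup>2)\<^sup>2 * (real d)\<^sup>2) * (1 / (n * (real n - 1)))
            \<le> 2 * ((K * ?F\<^sup>2)\<^sup>2 * (real d)\<^sup>2) * (2 / (real n)\<^sup>2)"
          by (rule mult_left_mono) simp
        then show ?thesis by simp
      qed
      also have "\<dots> = (\<alpha> * (\<zeta>\<^sub>2 \<alpha>)\<^sup>2) * (?F\<^sup>2)\<^sup>2 * (real d)\<^sup>2 / (2 * (real n)\<^sup>2)"
        by (subst \<zeta>(4)) (simp add: power_mult_distrib)
      also have "\<dots> = \<alpha> / 2 * (\<zeta>\<^sub>2 \<alpha> * ?F\<^sup>2 * d / n)\<^sup>2"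
        by (simp add: power_mult_distrib power_divide)
      finally show "2 * ((K * ?F\<^sup>2)\<^sup>2 * (real d)\<^sup>2) / (n * (real n - 1)) \<le> \<alpha> / 2 * (\<zeta>\<^sub>2 \<alpha> * ?F\<^sup>2 * d / n)\<^sup>2" .
      show "\<zeta>\<^sub>1 \<alpha> * ?F * ?G / sqrt n + \<zeta>\<^sub>2 \<alpha> * ?F\<^sup>2 * d / n \<le> z_term n d C\<^sub>1 C\<^sub>2 \<theta> \<theta>'"
        unfolding z_term_def using C G by (intro add_mono divide_right_mono mult_right_mono) auto
    qed (use K \<alpha> F G \<zeta> in auto)
  qed
qed

end
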